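(* Let $q$ be a prime power and $s$ a positive integer. For $a \in \mathbb{F}_{q^s}$ let $N(a) = a^{(q^s-1)/(q-1)} = a \cdot a^q \cdots a^{q^{s-1}} \in \mathbb{F}_q$. Let $N_{q,s}^o$ be the graph with vertex set $\mathbb{F}_{q^s}$ in which $a$ and $b$ (not necessarily distinct) are adjacent iff $N(a+b) = 1$; thus there is a loop at each $a$ with $N(2a)=1$, contributing $1$ to the corresponding diagonal entry of the adjacency matrix. Let $\lambda_1 \geq \lambda_2 \geq \cdots \geq \lambda_{q^s}$ be the eigenvalues of the adjacency matrix of $N_{q,s}^o$. Then for every $i > 1$, \[ |\lambda_i| \leq \sqrt{q^s}. \] *)

theory Defs
  imports
    "HOL-Number_Theory.Prime_Powers"
    "Jordan_Normal_Form.Char_Poly"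
    "Graph_Theory.Pair_Digraph"
begin

text \<open>
  The field with \<open>q\<^sup>s\<close> elements is represented by an arbitrary type of class \<open>field\<close> and \<open>finite\<close>
  whose cardinality is \<open>q\<^sup>s\<close>.  The norm to the subfield with \<open>q\<close> elements takes values in the
  same type; that subfield is the set of fixed points of \<open>x \<mapsto> x\<^sup>q\<close>.
\<close>

definition ff_norm :: "nat \<Rightarrow> nat \<Rightarrow> 'a::field \<Rightarrow> 'a" where
  "ff_norm q s a = a ^ ((q ^ s - 1) div (q - 1))"

lemma ff_norm_eq_prod:
  assumes "q \<ge> 2"
  shows "ff_norm q s a = (\<Prod>i<s. a ^ (q ^ i))"
proof -
  have "int (q ^ s - 1) = int ((q - 1) * (\<Sum>i<s. q ^ i))"
    using assms power_diff_1_eq[of "int q" s] by (simp add: of_nat_diff)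
  then have "q ^ s - 1 = (q - 1) * (\<Sum>i<s. q ^ i)"
    using of_nat_eq_iff by blast
  then have "(q ^ s - 1) div (q - 1) = (\<Sum>i<s. q ^ i)"
    using assms by simp
  then show ?thesis
    by (simp add: ff_norm_def power_sum)
qed

lemma ff_norm_in_subfield:
  fixes a :: "'a::{field,finite}"
  assumes "q \<ge> 2" "s \<ge> 1" and card: "card (UNIV :: 'a set) = q ^ s"
  shows "ff_norm q s a ^ q = ff_norm q s a"
proof (cases "a = 0")
  case True
  have "(0::'a) ^ q = 0" using assms by simp
  moreover have "ff_norm q s a = 0 \<or> ff_norm q s a = 1"
    using True by (simp add: ff_norm_def power_0_left)
  ultimately show ?thesis by auto
next
  case False
  have "bij_betw ((*) a) (UNIV - {0}) (UNIV - {0})"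
    using False by (intro bij_betwI[where g = "\<lambda>x. x / a"]) auto
  then have "(\<Prod>x\<in>UNIV - {0}. x) = (\<Prod>x\<in>UNIV - {0}. a * x)"
    using prod.reindex_bij_betw[of "(*) a" "UNIV - {0}" "UNIV - {0}" "\<lambda>x. x"] by simp
  also have "\<dots> = a ^ (q ^ s - 1) * (\<Prod>x\<in>UNIV - {0}. x)"
    using card by (simp add: prod.distrib card_Diff_singleton)
  finally have *: "a ^ (q ^ s - 1) = 1"
    by simp
  have "(q - 1) dvd (q ^ s - 1)"
  proof -
    have "int q - 1 dvd int q ^ s - 1"
      by (metis dvd_triv_left power_diff_1_eq)
    moreover have "int q - 1 = int (q - 1)" "int q ^ s - 1 = int (q ^ s - 1)"
      using assms by (auto simp: of_nat_diff)
    ultimately show ?thesis by (metis of_nat_dvd_iff)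
  qed
  then have "ff_norm q s a ^ (q - 1) = 1"
    using * by (simp add: ff_norm_def flip: power_mult)
  moreover have "q = Suc (q - 1)"
    using assms by simp
  ultimately show ?thesis
    by (metis mult.right_neutral power_Suc)
qed

text \<open>
  As usual for the library's digraphs, an undirected graph is a symmetric digraph; loops are the
  arcs \<open>(a, a)\<close>.
\<close>

definition norm_graph :: "nat \<Rightarrow> nat \<Rightarrow> 'a::{field,finite} pair_pre_digraph" where
  "norm_graph q s = \<lparr> pverts = UNIV, parcs = {(a, b). ff_norm q s (a + b) = 1} \<rparr>"

lemma pair_pseudo_graph_norm_graph:
  "pair_pseudo_graph (norm_graph q s :: 'a::{field,finite} pair_pre_digraph)"
  by unfold_locales
    (auto simp: norm_graph_def symmetric_def sym_def add.commute)

text \<open>\<open>vs\<close> is the list of vertices in the order in which they label rows and columns.\<close>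

definition adjacency_matrix :: "'a pair_pre_digraph \<Rightarrow> 'a list \<Rightarrow> real mat" where
  "adjacency_matrix G vs =
     mat (length vs) (length vs) (\<lambda>(i, j). if (vs ! i, vs ! j) \<in> parcs G then 1 else 0)"

text \<open>
  The real eigenvalues with algebraic multiplicity, in weakly decreasing order.  For a symmetric
  matrix there are as many as rows.
\<close>

definition eigenvalue_list :: "real mat \<Rightarrow> real list" where
  "eigenvalue_list A = rev (sorted_list_of_multiset (proots (char_poly A)))"

text \<open>The eigenvalue \<open>\<lambda>\<^sub>i\<close>, with indices starting at 1; unspecified if there is no such eigenvalue.\<close>

definition nth_eigenvalue :: "real mat \<Rightarrow> nat \<Rightarrow> real" where
  "nth_eigenvalue A i = eigenvalue_list A ! (i - 1)"

end

theory Submission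
  imports Defs
begin

text \<open>
  Let \<open>Q = q\<^sup>s\<close> and let \<open>H\<close> be the group of elements of norm 1, of size \<open>d\<close>.  For \<open>x \<noteq> 0\<close> put
  \<open>(A\<^sub>x f)(a) = (\<Sum>u\<in>H. f (x u - a))\<close>, so that \<open>A\<^sub>1\<close> is the adjacency operator.  If \<open>f\<close> has sum 0,
  then \<open>\<parallel>A\<^sub>x f\<parallel>\<^sup>2\<close> is a sum of autocorrelations of \<open>f\<close>, and summing over all \<open>x \<noteq> 0\<close> gives exactly
  \<open>d (Q - d) \<parallel>f\<parallel>\<^sup>2\<close>.  Since \<open>\<parallel>A\<^sub>x f\<parallel>\<close> depends only on the coset \<open>x H\<close>, the \<open>d\<close> terms with \<open>x \<in> H\<close>
  are equal, whence \<open>\<parallel>A\<^sub>1 f\<parallel>\<^sup>2 \<le> Q \<parallel>f\<parallel>\<^sup>2\<close> on the orthogonal complement of the constants.  The constants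
  account for one root \<open>d\<close> of the characteristic polynomial, and the quotient by them for all others.
\<close>

section \<open>Norm estimate by averaging over dilations of a finite field\<close>

lemma mult_subgroup_image:
  fixes H :: "'a::{field,finite} set"
  assumes "0 \<notin> H" and "\<And>x y. x \<in> H \<Longrightarrow> y \<in> H \<Longrightarrow> x * y \<in> H" and "x \<in> H"
  shows "(*) x ` H = H"
proof (rule card_subset_eq)
  have "x \<noteq> 0" using assms by auto
  then have "inj_on ((*) x) H" by (auto simp: inj_on_def)
  then show "card ((*) x ` H) = card H" by (rule card_image)
qed (use assms in auto)

lemma sum_shift:
  fixes g :: "'a::{field,finite} \<Rightarrow> real"
  shows "(\<Sum>a\<in>UNIV. g (a + c)) = sum g UNIV"
  by (rule sum.reindex_bij_witness[where i = "\<lambda>a. a - c" and j = "\<lambda>a. a + c"]) auto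

lemma sum_reflect:
  fixes g :: "'a::{field,finite} \<Rightarrow> real"
  shows "(\<Sum>a\<in>UNIV. g (c - a)) = sum g UNIV"
  by (rule sum.reindex_bij_witness[where i = "\<lambda>a. c - a" and j = "\<lambda>a. c - a"]) auto

lemma sum_dilate_nonzero:
  fixes g :: "'a::{field,finite} \<Rightarrow> real"
  assumes "c \<noteq> 0"
  shows "(\<Sum>x\<in>UNIV - {0}. g (x * c)) = sum g (UNIV - {0})"
  using assms
  by (intro sum.reindex_bij_witness[where i = "\<lambda>a. a / c" and j = "\<lambda>a. a * c"]) auto

text \<open>Expanding the square gives autocorrelations of \<open>f\<close> at
  \<open>x * (v - u)\<close>, summed over pairs \<open>u\<close>, \<open>v\<close> in
  \<open>H\<close>. With \<open>Q\<close> the field size and \<open>d = card H\<close>, each of the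
  \<open>d\<close> diagonal pairs contributes \<open>(Q - 1) * R 0\<close> and each of the
  \<open>d * (d - 1)\<close> others \<open>- R 0\<close>, in total
  \<open>d * (Q - d) * R 0\<close>.\<close>

lemma sum_square_dilated_sums:
  fixes f :: "'a::{field,finite} \<Rightarrow> real"
  assumes f: "sum f UNIV = 0"
  shows "(\<Sum>x\<in>UNIV - {0}. \<Sum>a\<in>UNIV. (\<Sum>u\<in>H. f (x * u - a))\<^sup>2)
       = real (card H) * (real (card (UNIV :: 'a set)) - real (card H)) * (\<Sum>a\<in>UNIV. (f a)\<^sup>2)"
proof -
  define R where "R t = (\<Sum>a\<in>UNIV. f a * f (a + t))" for t
  have corr: "(\<Sum>a\<in>UNIV. f (x * u - a) * f (x * v - a)) = R (x * (v - u))" for x u v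
    unfolding R_def
    using sum_reflect[of "\<lambda>a. f a * f (a + x * (v - u))" "x * u"]
    by (simp add: algebra_simps)
  \<comment> \<open>The total autocorrelation factors as the square of
    \<open>sum f UNIV\<close>.\<close>
  have R_sum: "sum R UNIV = 0"
  proof -
    have "sum R UNIV = (\<Sum>a\<in>UNIV. f a * (\<Sum>t\<in>UNIV. f (t + a)))"
      unfolding R_def by (subst sum.swap) (simp add: sum_distrib_left add.commute)
    also have "\<dots> = 0" using f by (simp add: sum_shift)
    finally show ?thesis .
  qed
  have R_nz: "sum R (UNIV - {0}) = - R 0"
    using R_sum sum.remove[of UNIV "0::'a" R] by simp
  have inner: "(\<Sum>x\<in>UNIV - {0}. R (x * (v - u))) = (if u = v then real (card (UNIV :: 'a set)) * R 0 else 0) - R 0"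
    for u v
  proof (cases "u = v")
    case True
    have "real ((card (UNIV :: 'a set)) - 1) = real (card (UNIV :: 'a set)) - 1"
      by (simp add: of_nat_diff Suc_leI card_gt_0_iff)
    then show ?thesis using True by (simp add: card_Diff_singleton algebra_simps)
  next
    case False
    then show ?thesis using sum_dilate_nonzero[of "v - u" R] R_nz by simp
  qed
  have "(\<Sum>x\<in>UNIV - {0}. \<Sum>a\<in>UNIV. (\<Sum>u\<in>H. f (x * u - a))\<^sup>2)
      = (\<Sum>x\<in>UNIV - {0}. \<Sum>a\<in>UNIV. \<Sum>u\<in>H. \<Sum>v\<in>H. f (x * u - a) * f (x * v - a))"
    by (simp add: power2_eq_square sum_product)
  also have "\<dots> = (\<Sum>x\<in>UNIV - {0}. \<Sum>u\<in>H. \<Sum>v\<in>H. \<Sum>a\<in>UNIV. f (x * u - a) * f (x * v - a))"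
    by (subst sum.swap, subst (2) sum.swap) (rule refl)
  also have "\<dots> = (\<Sum>x\<in>UNIV - {0}. \<Sum>u\<in>H. \<Sum>v\<in>H. R (x * (v - u)))"
    by (simp add: corr)
  also have "\<dots> = (\<Sum>u\<in>H. \<Sum>v\<in>H. \<Sum>x\<in>UNIV - {0}. R (x * (v - u)))"
    by (subst sum.swap, subst (2) sum.swap) (rule refl)
  also have "\<dots> = (\<Sum>u\<in>H. real (card (UNIV :: 'a set)) * R 0 - real (card H) * R 0)"
    by (simp add: inner sum_subtractf)
  also have "\<dots> = real (card H) * (real (card (UNIV :: 'a set)) - real (card H)) * R 0"
    by (simp add: algebra_simps)
  finally show ?thesis by (simp add: R_def power2_eq_square)
qed

lemma mult_subgroup_sum_bound:
  fixes f :: "'a::{field,finite} \<Rightarrow> real"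
  assumes H: "0 \<notin> H" "H \<noteq> {}" "\<And>x y. x \<in> H \<Longrightarrow> y \<in> H \<Longrightarrow> x * y \<in> H"
    and f: "sum f UNIV = 0"
  shows "(\<Sum>a\<in>UNIV. (\<Sum>u\<in>H. f (u - a))\<^sup>2) \<le> real (card (UNIV :: 'a set)) * (\<Sum>a\<in>UNIV. (f a)\<^sup>2)"
proof -
  define S where "S x = (\<Sum>a\<in>UNIV. (\<Sum>u\<in>H. f (x * u - a))\<^sup>2)" for x
  \<comment> \<open>Multiplication by \<open>x\<close> only permutes the summation set
    \<open>H\<close>.\<close>
  have S_H: "S x = S 1" if "x \<in> H" for x
  proof -
    have "inj_on ((*) x) H" using that H(1) by (auto simp: inj_on_def)
    then have "(\<Sum>u\<in>H. f (x * u - a)) = (\<Sum>u\<in>H. f (u - a))" for a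
      using sum.reindex[of "(*) x" H "\<lambda>u. f (u - a)"] mult_subgroup_image[OF H(1,3) that]
      by simp
    then show ?thesis by (simp add: S_def)
  qed
  have d: "card H > 0" using H(2) by (simp add: card_gt_0_iff)
  have "real (card H) * S 1 = (\<Sum>x\<in>H. S x)" by (simp add: S_H)
  \<comment> \<open>All \<open>S x\<close> are nonnegative, so the terms outside \<open>H\<close>
    may be added.\<close>
  also have "\<dots> \<le> (\<Sum>x\<in>UNIV - {0}. S x)"
    using H(1) by (intro sum_mono2) (auto simp: S_def intro!: sum_nonneg)
  also have "\<dots> = real (card H) * ((real (card (UNIV :: 'a set)) - real (card H)) * (\<Sum>a\<in>UNIV. (f a)\<^sup>2))"
    unfolding S_def by (simp add: sum_square_dilated_sums[OF f])
  finally have "S 1 \<le> (real (card (UNIV :: 'a set)) - real (card H)) * (\<Sum>a\<in>UNIV. (f a)\<^sup>2)"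
    using d by simp
  also have "\<dots> \<le> real (card (UNIV :: 'a set)) * (\<Sum>a\<in>UNIV. (f a)\<^sup>2)"
    by (intro mult_right_mono sum_nonneg) auto
  finally show ?thesis by (simp add: S_def)
qed

section \<open>Spectra of real symmetric matrices with constant row sums\<close>

text \<open>The characteristic polynomial splits over the complex numbers, and symmetry forces every
  root to be real. This guarantees the full number of real eigenvalues.\<close>

lemma real_symmetric_char_poly_splits:
  fixes A :: "real mat"
  assumes A: "A \<in> carrier_mat n n" and sym: "\<And>i j. i < n \<Longrightarrow> j < n \<Longrightarrow> A $$ (i,j) = A $$ (j,i)"
  shows "\<exists>rs. char_poly A = (\<Prod>r\<leftarrow>rs. [:- r, 1:]) \<and> length rs = n"
proof -
  let ?A = "map_mat complex_of_real A"
  have cA: "?A \<in> carrier_mat n n" using A by simp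
  obtain zs where zs: "char_poly ?A = (\<Prod>z\<leftarrow>zs. [:- z, 1:])" "length zs = n"
    using char_poly_factorized[OF cA] by blast
  have real: "complex_of_real (Re z) = z" if "z \<in> set zs" for z
  proof -
    have "poly (char_poly ?A) z = 0"
      using that by (simp add: zs poly_prod_list prod_list_zero_iff o_def image_iff)
    then obtain w where w: "w \<in> carrier_vec n" "w \<noteq> 0\<^sub>v n" "?A *\<^sub>v w = z \<cdot>\<^sub>v w"
      using eigenvalue_root_char_poly[OF cA] A by (auto simp: eigenvalue_def eigenvector_def)
    \<comment> \<open>The Hermitian form of the matrix at \<open>w\<close>: it equals
      \<open>z\<close> times the squared norm of \<open>w\<close>, and symmetry makes it its own
      conjugate.\<close>
    define t where "t = (\<Sum>i<n. \<Sum>j<n. cnj (w $ i) * (of_real (A $$ (i,j)) * w $ j))"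
    have row: "(\<Sum>j<n. of_real (A $$ (i,j)) * w $ j) = z * w $ i" if "i < n" for i
    proof -
      have "(?A *\<^sub>v w) $ i = (\<Sum>j<n. of_real (A $$ (i,j)) * w $ j)"
        using that A w(1) by (simp add: scalar_prod_def lessThan_atLeast0)
      then show ?thesis using w that by simp
    qed
    have "t = (\<Sum>i<n. cnj (w $ i) * (z * w $ i))"
      unfolding t_def by (simp add: row flip: sum_distrib_left)
    also have "\<dots> = z * of_real (\<Sum>i<n. (cmod (w $ i))\<^sup>2)"
      by (simp add: sum_distrib_left complex_norm_square mult_ac flip: of_real_power)
    finally have t: "t = z * of_real (\<Sum>i<n. (cmod (w $ i))\<^sup>2)" .
    have "cnj t = (\<Sum>i<n. \<Sum>j<n. w $ i * (of_real (A $$ (i,j)) * cnj (w $ j)))"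
      unfolding t_def by simp
    also have "\<dots> = (\<Sum>j<n. \<Sum>i<n. w $ i * (of_real (A $$ (i,j)) * cnj (w $ j)))"
      by (rule sum.swap)
    also have "\<dots> = t"
      unfolding t_def
    proof (intro sum.cong refl)
      fix j i assume "j \<in> {..<n}" "i \<in> {..<n}"
      then have "A $$ (i,j) = A $$ (j,i)" by (simp add: sym)
      then show "w $ i * (of_real (A $$ (i,j)) * cnj (w $ j))
          = cnj (w $ j) * (of_real (A $$ (j,i)) * w $ i)"
        by (simp only: mult_ac)
    qed
    finally have "Im t = 0" by (simp add: complex_eq_iff)
    obtain i where i: "i < n" "w $ i \<noteq> 0" using w(1,2) by (metis carrier_vecD eq_vecI index_zero_vec)
    have "(\<Sum>i<n. (cmod (w $ i))\<^sup>2) > 0" using i by (intro sum_pos2[of _ i]) auto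
    with \<open>Im t = 0\<close> show ?thesis by (simp add: t complex_eq_iff)
  qed
  \<comment> \<open>Injectivity of the coefficient embedding brings the factorization back to real
    polynomials.\<close>
  interpret h: map_poly_inj_comm_ring_hom complex_of_real ..
  have "map_poly complex_of_real (char_poly A) = char_poly ?A"
    by (rule of_real_hom.char_poly_hom[OF A, symmetric])
  also have "\<dots> = map_poly complex_of_real (\<Prod>r\<leftarrow>map Re zs. [:- r, 1:])"
    using real unfolding zs(1)
    by (induction zs) (auto simp: h.hom_mult of_real_hom.map_poly_pCons_hom simp del: mult_pCons_left)
  finally have "char_poly A = (\<Prod>r\<leftarrow>map Re zs. [:- r, 1:])"
    by simp
  then show ?thesis using zs(2) by (intro exI[of _ "map Re zs"]) simp
qed

text \<open>The all-ones vector spans an invariant line with eigenvalue \<open>d\<close>. The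
  smaller matrix is the action on the quotient by that line, in the basis of the images of all unit
  vectors but the first; subtracting row 0 normalizes coordinate 0 to zero.\<close>

lemma char_poly_constant_row_sums:
  fixes A :: "'a::field mat"
  assumes A: "A \<in> carrier_mat (Suc m) (Suc m)"
    and row: "\<And>i. i < Suc m \<Longrightarrow> (\<Sum>j<Suc m. A $$ (i,j)) = d"
  shows "char_poly A =
    [:- d, 1:] * char_poly (mat m m (\<lambda>(i,j). A $$ (Suc i, Suc j) - A $$ (0, Suc j)))"
proof -
  define C where "C = mat m m (\<lambda>(i,j). A $$ (Suc i, Suc j) - A $$ (0, Suc j))"
  \<comment> \<open>\<open>B\<close> is \<open>A\<close> in the basis formed by the all-ones vector
    and the unit vectors with index at least 1. These are the columns of \<open>P\<close>, and
    \<open>Q\<close> is the inverse of \<open>P\<close>.\<close>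
  define B where "B = four_block_mat (mat 1 1 (\<lambda>_. d)) (mat 1 m (\<lambda>(i,j). A $$ (0, Suc j))) (0\<^sub>m m 1) C"
  define P :: "'a mat" where "P = mat (Suc m) (Suc m) (\<lambda>(i,j). if i = j \<or> j = 0 then 1 else 0)"
  define Q :: "'a mat" where
    "Q = mat (Suc m) (Suc m) (\<lambda>(i,j). if i = j then 1 else if j = 0 then -1 else 0)"
  have C: "C \<in> carrier_mat m m" by (simp add: C_def)
  have B: "B \<in> carrier_mat (Suc m) (Suc m)"
    unfolding B_def using four_block_carrier_mat[of "mat 1 1 (\<lambda>_. d)" 1 1 C m m] C by simp
  have P: "P \<in> carrier_mat (Suc m) (Suc m)" by (simp add: P_def)
  have Q: "Q \<in> carrier_mat (Suc m) (Suc m)" by (simp add: Q_def)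
  have P_sum: "(\<Sum>k<Suc m. P $$ (i,k) * f k) = (if i = 0 then f 0 else f 0 + f i)"
    if "i < Suc m" for i and f :: "nat \<Rightarrow> 'a"
  proof -
    have "(\<Sum>k<Suc m. P $$ (i,k) * f k)
        = (\<Sum>k<Suc m. (if i = k then f k else 0) + (if 0 = k then if i = 0 then 0 else f k else 0))"
      using that by (intro sum.cong) (auto simp: P_def)
    then show ?thesis
      using that by (simp add: sum.distrib del: sum.lessThan_Suc)
  qed
  have P_mult: "(P * X) $$ (i,j) = (if i = 0 then X $$ (0,j) else X $$ (0,j) + X $$ (i,j))"
    if "X \<in> carrier_mat (Suc m) (Suc m)" "i < Suc m" "j < Suc m" for X :: "'a mat" and i j
    using that P P_sum[of i "\<lambda>k. X $$ (k,j)"]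
    by (simp add: scalar_prod_def lessThan_atLeast0 del: sum.lessThan_Suc sum.op_ivl_Suc)
  have PQ: "P * Q = 1\<^sub>m (Suc m)"
  proof (rule eq_matI)
    fix i j assume "i < dim_row (1\<^sub>m (Suc m) :: 'a mat)" "j < dim_col (1\<^sub>m (Suc m) :: 'a mat)"
    then show "(P * Q) $$ (i,j) = 1\<^sub>m (Suc m) $$ (i,j)"
      using P_mult[OF Q, of i j] by (auto simp: Q_def)
  qed (use P Q in auto)
  then have QP: "Q * P = 1\<^sub>m (Suc m)"
    using mat_mult_left_right_inverse[OF P Q] by simp
  have "A * P = P * B"
  proof (rule eq_matI)
    fix i j assume "i < dim_row (P * B)" "j < dim_col (P * B)"
    then have ij: "i < Suc m" "j < Suc m" using P B by auto
    have "(A * P) $$ (i,j) = (\<Sum>k<Suc m. A $$ (i,k) * P $$ (k,j))"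
      using ij A P by (simp add: scalar_prod_def lessThan_atLeast0 del: sum.lessThan_Suc sum.op_ivl_Suc)
    also have "\<dots> = (if j = 0 then d else A $$ (i,j))"
    proof (cases "j = 0")
      case True
      have "(\<Sum>k<Suc m. A $$ (i,k) * P $$ (k,j)) = (\<Sum>k<Suc m. A $$ (i,k))"
        using True by (intro sum.cong) (auto simp: P_def)
      then show ?thesis using row[OF ij(1)] True by simp
    next
      case False
      have "(\<Sum>k<Suc m. A $$ (i,k) * P $$ (k,j)) = (\<Sum>k<Suc m. if k = j then A $$ (i,k) else 0)"
        using False ij by (intro sum.cong) (auto simp: P_def)
      then show ?thesis using ij False by (simp del: sum.lessThan_Suc)
    qed
    also have "\<dots> = (P * B) $$ (i,j)"
      using ij unfolding P_mult[OF B ij] by (auto simp: B_def C_def less_Suc_eq_0_disj)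
    finally show "(A * P) $$ (i,j) = (P * B) $$ (i,j)" .
  qed (use A B P in auto)
  then have "A = P * B * Q"
    using A P Q B PQ by (metis assoc_mult_mat right_mult_one_mat)
  then have "similar_mat A B"
    unfolding similar_mat_def using similar_mat_witI[OF PQ QP _ A B P Q] by blast
  then have "char_poly A = char_poly (mat 1 1 (\<lambda>_. d)) * char_poly C"
    unfolding B_def
    by (subst char_poly_similar, assumption) (rule char_poly_four_block_zeros_col; simp add: C)
  also have "char_poly (mat 1 1 (\<lambda>_. d)) = [:- d, 1:]"
    by (simp add: char_poly_defs det_def sign_def)
  finally show ?thesis by (simp add: C_def)
qed

text \<open>
  An eigenvector of the quotient matrix lifts to an eigenvector of \<open>A\<close> modulo constants; removing
  its mean leaves a genuine eigenvector orthogonal to the constants.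
\<close>

lemma quotient_eigenvalue_bound:
  fixes A :: "real mat"
  assumes A: "A \<in> carrier_mat (Suc m) (Suc m)"
    and sym: "\<And>i j. i < Suc m \<Longrightarrow> j < Suc m \<Longrightarrow> A $$ (i,j) = A $$ (j,i)"
    and row: "\<And>i. i < Suc m \<Longrightarrow> (\<Sum>j<Suc m. A $$ (i,j)) = d"
    and bound: "\<And>g. (\<Sum>j<Suc m. g j) = 0 \<Longrightarrow>
       (\<Sum>i<Suc m. (\<Sum>j<Suc m. A $$ (i,j) * g j)\<^sup>2) \<le> b\<^sup>2 * (\<Sum>j<Suc m. (g j)\<^sup>2)"
    and b: "b \<ge> 0"
    and r: "poly (char_poly (mat m m (\<lambda>(i,j). A $$ (Suc i, Suc j) - A $$ (0, Suc j)))) r = 0"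
  shows "\<bar>r\<bar> \<le> b"
proof -
  let ?C = "mat m m (\<lambda>(i,j). A $$ (Suc i, Suc j) - A $$ (0, Suc j))"
  have C: "?C \<in> carrier_mat m m" by simp
  obtain w where w: "w \<in> carrier_vec m" "w \<noteq> 0\<^sub>v m" "?C *\<^sub>v w = r \<cdot>\<^sub>v w"
    using r eigenvalue_root_char_poly[OF C] by (auto simp: eigenvalue_def eigenvector_def)
  \<comment> \<open>The representative of \<open>w\<close> modulo constants that vanishes at index
    0; \<open>c\<close> below is the constant by which it fails to be an eigenvector.\<close>
  define h where "h j = (case j of 0 \<Rightarrow> 0 | Suc k \<Rightarrow> w $ k)" for j
  define c where "c = (\<Sum>j<Suc m. A $$ (0,j) * h j)"
  have Ah: "(\<Sum>j<Suc m. A $$ (i,j) * h j) = c + r * h i" if "i < Suc m" for i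
  proof (cases i)
    case 0
    then show ?thesis by (simp add: c_def h_def)
  next
    case (Suc k)
    have "(?C *\<^sub>v w) $ k = (\<Sum>j<m. (A $$ (i, Suc j) - A $$ (0, Suc j)) * w $ j)"
      using that Suc w(1) by (simp add: scalar_prod_def lessThan_atLeast0)
    then have "r * w $ k = (\<Sum>j<m. (A $$ (i, Suc j) - A $$ (0, Suc j)) * w $ j)"
      using that Suc w by simp
    then show ?thesis
      unfolding c_def sum.lessThan_Suc_shift
      by (simp add: h_def Suc left_diff_distrib sum_subtractf)
  qed
  define \<mu> where "\<mu> = (\<Sum>j<Suc m. h j) / real (Suc m)"
  define g where "g j = h j - \<mu>" for j
  have g0: "(\<Sum>j<Suc m. g j) = 0"
    by (simp add: g_def sum_subtractf \<mu>_def del: sum.lessThan_Suc of_nat_Suc)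
  define c' where "c' = c + r * \<mu> - d * \<mu>"
  have Ag: "(\<Sum>j<Suc m. A $$ (i,j) * g j) = r * g i + c'" if "i < Suc m" for i
  proof -
    have "(\<Sum>j<Suc m. A $$ (i,j) * g j) =
        (\<Sum>j<Suc m. A $$ (i,j) * h j) - (\<Sum>j<Suc m. A $$ (i,j)) * \<mu>"
      by (simp add: g_def right_diff_distrib sum_subtractf sum_distrib_right del: sum.lessThan_Suc)
    then show ?thesis
      by (simp add: Ah row that c'_def g_def right_diff_distrib del: sum.lessThan_Suc)
  qed
  \<comment> \<open>Summing over all rows isolates the constant error \<open>c'\<close>: by symmetry
    the column sums are also \<open>d\<close>, so the total is \<open>d\<close> times the sum of
    \<open>g\<close>, which is 0.\<close>
  have "real (Suc m) * c' = (\<Sum>i<Suc m. r * g i + c')"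
    by (simp add: sum.distrib g0 flip: sum_distrib_left del: sum.lessThan_Suc of_nat_Suc)
  also have "\<dots> = (\<Sum>i<Suc m. \<Sum>j<Suc m. A $$ (i,j) * g j)"
    by (rule sum.cong) (simp_all add: Ag del: sum.lessThan_Suc)
  also have "\<dots> = (\<Sum>j<Suc m. \<Sum>i<Suc m. A $$ (i,j) * g j)"
    by (rule sum.swap)
  also have "\<dots> = (\<Sum>j<Suc m. \<Sum>i<Suc m. A $$ (j,i) * g j)"
    by (intro sum.cong refl) (simp add: sym)
  also have "\<dots> = (\<Sum>j<Suc m. d * g j)"
    by (rule sum.cong) (simp_all add: row flip: sum_distrib_right del: sum.lessThan_Suc)
  also have "\<dots> = 0"
    by (simp add: g0 flip: sum_distrib_left del: sum.lessThan_Suc)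
  finally have c': "c' = 0" by simp
  define T where "T = (\<Sum>j<Suc m. (g j)\<^sup>2)"
  have "r\<^sup>2 * T = (\<Sum>i<Suc m. (\<Sum>j<Suc m. A $$ (i,j) * g j)\<^sup>2)"
    unfolding T_def sum_distrib_left
    by (rule sum.cong) (simp_all add: Ag c' power_mult_distrib del: sum.lessThan_Suc)
  also have "\<dots> \<le> b\<^sup>2 * T"
    using bound[OF g0] by (simp only: T_def)
  finally have le: "r\<^sup>2 * T \<le> b\<^sup>2 * T" .
  \<comment> \<open>If \<open>g\<close> vanished, \<open>h\<close> would be constant, hence zero by
    its value at index 0, and so would \<open>w\<close>.\<close>
  have "T \<noteq> 0"
  proof
    assume "T = 0"
    then have z: "g j = 0" if "j < Suc m" for j
      using that unfolding T_def by (subst (asm) sum_nonneg_eq_0_iff) auto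
    have "\<mu> = 0" using z[of 0] by (simp add: g_def h_def)
    then have "w $ k = 0" if "k < m" for k
      using z[of "Suc k"] that by (simp add: g_def h_def)
    then have "w = 0\<^sub>v m" using w(1) by (intro eq_vecI) auto
    with w(2) show False ..
  qed
  moreover have "T \<ge> 0" unfolding T_def by (intro sum_nonneg) auto
  ultimately have "r\<^sup>2 \<le> b\<^sup>2" using le by simp
  then show ?thesis using b by (simp add: abs_le_square_iff[symmetric])
qed

section \<open>From roots with multiplicity to the ordered eigenvalue list\<close>

lemma proots_prod_linear: "proots (\<Prod>r\<leftarrow>rs. [:- r, 1:]) = mset (rs :: real list)"
proof (induction rs)
  case (Cons r rs)
  have "(\<Prod>r\<leftarrow>rs. [:- r, 1:]) \<noteq> 0" by (auto simp: prod_list_zero_iff)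
  with Cons show ?case by (simp add: proots_mult del: mult_pCons_left)
qed simp

text \<open>An entry violating the bound can only be \<open>d\<close>, so \<open>d > b\<close>. The
  entry at index 0 is at least as large, hence also \<open>d\<close>; removing it leaves exactly
  \<open>P\<close>, which would still contain \<open>d\<close>.\<close>

lemma rev_sorted_nth_bound:
  fixes d b :: real
  assumes M: "M = add_mset d P" and P: "\<And>x. x \<in># P \<Longrightarrow> \<bar>x\<bar> \<le> b" and d: "d \<ge> 0"
    and k: "0 < k" "k < size M"
  shows "\<bar>rev (sorted_list_of_multiset M) ! k\<bar> \<le> b"
proof (rule ccontr)
  define L where "L = rev (sorted_list_of_multiset M)"
  assume "\<not> ?thesis"
  then have neg: "\<bar>L ! k\<bar> > b" by (simp add: L_def)
  have msL: "mset L = M" by (simp add: L_def)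
  have len: "length L = size M" by (metis msL size_mset)
  have "L ! k \<in># M" using k len msL by (metis nth_mem set_mset_mset)
  with M P neg have Lk: "L ! k = d" by fastforce
  with neg d have db: "d > b" by simp
  have "sorted (rev L)" by (simp add: L_def)
  then have ge: "L ! 0 \<ge> L ! k" using k len by (simp add: sorted_rev_nth_mono)
  have "L ! 0 \<in># M" using k len msL by (metis gr_implies_not0 neq0_conv nth_mem set_mset_mset)
  with M P ge Lk db have L0: "L ! 0 = d" by fastforce
  have "L = L ! 0 # tl L" using k len by (cases L) auto
  then have "mset (tl L) = P" using msL M L0 by (metis add_mset_add_mset_same_iff add_mset_remove_trivial mset.simps(2))
  moreover have "L ! k \<in> set (tl L)" using k len by (cases L; cases k) auto
  ultimately have "d \<in># P" using Lk by (metis set_mset_mset)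
  with P db show False by fastforce
qed

lemma nth_eigenvalue_bound:
  fixes A :: "real mat"
  assumes A: "A \<in> carrier_mat n n"
    and sym: "\<And>i j. i < n \<Longrightarrow> j < n \<Longrightarrow> A $$ (i,j) = A $$ (j,i)"
    and row: "\<And>i. i < n \<Longrightarrow> (\<Sum>j<n. A $$ (i,j)) = d" and d: "d \<ge> 0"
    and bound: "\<And>g. (\<Sum>j<n. g j) = 0 \<Longrightarrow>
       (\<Sum>i<n. (\<Sum>j<n. A $$ (i,j) * g j)\<^sup>2) \<le> b\<^sup>2 * (\<Sum>j<n. (g j)\<^sup>2)"
    and b: "b \<ge> 0" and i: "1 < i" "i \<le> n"
  shows "\<bar>nth_eigenvalue A i\<bar> \<le> b"
proof -
  obtain m where n: "n = Suc m" using i by (cases n) auto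
  let ?C = "mat m m (\<lambda>(i,j). A $$ (Suc i, Suc j) - A $$ (0, Suc j))"
  have cp: "char_poly A = [:- d, 1:] * char_poly ?C"
    using A row unfolding n by (rule char_poly_constant_row_sums)
  have nz: "char_poly ?C \<noteq> 0"
    using degree_monic_char_poly[of ?C m] by auto
  obtain rs where rs: "char_poly A = (\<Prod>r\<leftarrow>rs. [:- r, 1:])" "length rs = n"
    using real_symmetric_char_poly_splits[OF A sym] by blast
  \<comment> \<open>There are \<open>n\<close> real roots, so the zero-based index
    \<open>i - 1\<close> lies within the list.\<close>
  have size: "size (proots (char_poly A)) = n"
    by (simp add: rs proots_prod_linear)
  have split: "proots (char_poly A) = add_mset d (proots (char_poly ?C))"
    unfolding cp using nz by (subst proots_mult) auto
  have "\<bar>r\<bar> \<le> b" if "r \<in># proots (char_poly ?C)" for r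
    using that nz A sym row bound b unfolding n
    by (intro quotient_eigenvalue_bound[of A m d b r]) auto
  then show ?thesis
    unfolding nth_eigenvalue_def eigenvalue_list_def
    using split d i size by (intro rev_sorted_nth_bound) auto
qed

section \<open>Application to the norm graph\<close>

text \<open>The exponent is positive since \<open>q ^ s\<close> is at least \<open>q\<close>. This
  keeps 0 out of the norm-1 group.\<close>

lemma ff_norm_zero:
  assumes "q \<ge> 2" "s \<ge> 1"
  shows "ff_norm q s (0::'a::field) = 0"
proof -
  have "q \<le> q ^ s" using assms by (simp add: self_le_power)
  then have "(q ^ s - 1) div (q - 1) > 0" using assms by (simp add: div_greater_zero_iff)
  then show ?thesis unfolding ff_norm_def by (rule zero_power)
qed

theorem theorem6p1:
  fixes q s i :: nat and vs :: "'a::{field,finite} list"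
  assumes "primepow q" and "s \<ge> 1" and "card (UNIV :: 'a set) = q ^ s"
    and "distinct vs" and "set vs = pverts (norm_graph q s :: 'a pair_pre_digraph)"
    and "1 < i" and "i \<le> q ^ s"
  shows "\<bar>nth_eigenvalue (adjacency_matrix (norm_graph q s) vs) i\<bar> \<le> sqrt (real (q ^ s))"
proof -
  define n where "n = length vs"
  define A where "A = adjacency_matrix (norm_graph q s) vs"
  define H :: "'a set" where "H = {u. ff_norm q s u = 1}"
  have q: "q \<ge> 2" using primepow_gt_Suc_0[OF assms(1)] by simp
  have vs: "set vs = UNIV" using assms(5) by (simp add: norm_graph_def)
  have n: "n = q ^ s" using assms(3,4) vs distinct_card by (metis n_def)
  have bij: "bij_betw ((!) vs) {..<n} UNIV"
    using bij_betw_nth[OF assms(4), of "{..<n}" UNIV] vs by (simp add: n_def)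
  have reindex: "(\<Sum>j<n. f (vs ! j)) = sum f UNIV" for f :: "'a \<Rightarrow> real"
    using sum.reindex_bij_betw[OF bij] .
  have H0: "0 \<notin> H"
    using ff_norm_zero[OF q assms(2), where 'a = 'a] by (simp add: H_def)
  have H: "1 \<in> H" "\<And>x y. x \<in> H \<Longrightarrow> y \<in> H \<Longrightarrow> x * y \<in> H"
    by (auto simp: H_def ff_norm_def power_mult_distrib)
  have entry: "A $$ (i,j) = (if vs ! i + vs ! j \<in> H then 1 else 0)" if "i < n" "j < n" for i j
    using that by (simp add: A_def adjacency_matrix_def n_def norm_graph_def H_def)
  have apply_row: "(\<Sum>j<n. A $$ (i,j) * f (vs ! j)) = (\<Sum>u\<in>H. f (u - vs ! i))"
    if "i < n" for i and f :: "'a \<Rightarrow> real"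
  proof -
    have "(\<Sum>j<n. A $$ (i,j) * f (vs ! j)) = (\<Sum>j<n. if vs ! i + vs ! j \<in> H then f (vs ! j) else 0)"
      using that by (intro sum.cong) (auto simp: entry)
    also have "\<dots> = (\<Sum>b\<in>UNIV. if vs ! i + b \<in> H then f b else 0)"
      by (rule reindex)
    also have "\<dots> = (\<Sum>b | vs ! i + b \<in> H. f b)"
      by (simp add: sum.If_cases)
    also have "\<dots> = (\<Sum>u\<in>H. f (u - vs ! i))"
      \<comment> \<open>Substituting \<open>u = vs ! i + b\<close> turns the sum over neighbours
        into a sum over \<open>H\<close>.\<close>
      by (rule sum.reindex_bij_witness[where i = "\<lambda>u. u - vs ! i" and j = "\<lambda>b. vs ! i + b"]) auto
    finally show ?thesis .
  qed
  have "\<bar>nth_eigenvalue A i\<bar> \<le> sqrt (real n)"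
  proof (rule nth_eigenvalue_bound)
    show "A \<in> carrier_mat n n" by (simp add: A_def adjacency_matrix_def n_def)
    show "A $$ (i,j) = A $$ (j,i)" if "i < n" "j < n" for i j
      using that by (simp add: entry add.commute)
    show "(\<Sum>j<n. A $$ (i,j)) = real (card H)" if "i < n" for i
      using apply_row[OF that, of "\<lambda>_. 1"] by simp
    fix g :: "nat \<Rightarrow> real"
    assume g: "(\<Sum>j<n. g j) = 0"
    \<comment> \<open>Transports \<open>g\<close> from list positions to field elements, where the
      averaging bound applies.\<close>
    define f where "f a = g (the_inv_into {..<n} ((!) vs) a)" for a
    have f: "g j = f (vs ! j)" if "j < n" for j
      using that bij by (simp add: f_def the_inv_into_f_f bij_betw_def)
    have "(\<Sum>a\<in>UNIV. f a) = 0"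
      using g by (simp add: f flip: reindex)
    then have "(\<Sum>a\<in>UNIV. (\<Sum>u\<in>H. f (u - a))\<^sup>2) \<le> real (card (UNIV :: 'a set)) * (\<Sum>a\<in>UNIV. (f a)\<^sup>2)"
      using H0 H by (intro mult_subgroup_sum_bound) auto
    moreover have "(\<Sum>i<n. (\<Sum>j<n. A $$ (i,j) * g j)\<^sup>2) = (\<Sum>a\<in>UNIV. (\<Sum>u\<in>H. f (u - a))\<^sup>2)"
      unfolding reindex[symmetric] by (simp add: f apply_row)
    moreover have "(\<Sum>j<n. (g j)\<^sup>2) = (\<Sum>a\<in>UNIV. (f a)\<^sup>2)"
      unfolding reindex[symmetric] by (simp add: f)
    ultimately show "(\<Sum>i<n. (\<Sum>j<n. A $$ (i,j) * g j)\<^sup>2) \<le> (sqrt (real n))\<^sup>2 * (\<Sum>j<n. (g j)\<^sup>2)"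
      using assms(3) n by simp
  qed (use assms(6,7) n in auto)
  then show ?thesis by (simp add: A_def n)
qed

end
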